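(* Let $n\ge 1$ and $m\ge 0$ be integers and let $f:\mathbb{R}^n\to\mathbb{R}$ satisfy Fréchet's functional equation \[ \Delta_h^{m+1}f(x)=0\quad\text{for all } x,h\in\mathbb{R}^n . \] Suppose that $f(x_1,\dots,x_n)$ is not an ordinary algebraic polynomial in the variables $x_1,\dots,x_n$. Then $f$ is locally unbounded. Furthermore, $\overline{G(f)}^{\mathbb{R}^{n+1}}$ contains an unbounded open subset of $\mathbb{R}^{n+1}$.
   Context: For $f:\mathbb{R}^n\to\mathbb{R}$ and $h\in\mathbb{R}^n$, $\Delta_h^1 f(x)=f(x+h)-f(x)$ and $\Delta_h^{k+1}f(x)=\Delta_h^1(\Delta_h^k f)(x)$ for $k\ge1$; explicitly $\Delta_h^{m+1}f(x)=\sum_{k=0}^{m+1}\binom{m+1}{k}(-1)^{m+1-k}f(x+kh)$. An ordinary algebraic polynomial is a function given by a polynomial in $x_1,\dots,x_n$ with real coefficients. A function $f:\mathbb{R}^n\to\mathbb{R}$ is locally unbounded if it is unbounded on every non-empty open set $U\subseteq\mathbb{R}^n$. $G(f)=\{(x,f(x)):x\in\mathbb{R}^n\}\subseteq\mathbb{R}^{n+1}$ is the graph of $f$, and $\overline{G(f)}^{\mathbb{R}^{n+1}}$ is its closure in $\mathbb{R}^{n+1}$ (Euclidean topology). *)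

theory Defs
  imports "HOL-Analysis.Analysis"
begin

primrec fwd_diff :: "nat \<Rightarrow> 'a::ab_group_add \<Rightarrow> ('a \<Rightarrow> real) \<Rightarrow> 'a \<Rightarrow> real" where
  "fwd_diff 0 h f = f"
| "fwd_diff (Suc k) h f = (\<lambda>x. fwd_diff k h f (x + h) - fwd_diff k h f x)"

definition locally_unbounded :: "('a::topological_space \<Rightarrow> real) \<Rightarrow> bool" where
  "locally_unbounded f \<longleftrightarrow> (\<forall>U. open U \<and> U \<noteq> {} \<longrightarrow> \<not> bounded (f ` U))"

(* R^(n+1) is taken as R^n x R, whose product metric in HOL-Analysis is the Euclidean one. *)
definition graph_of :: "('a \<Rightarrow> real) \<Rightarrow> ('a \<times> real) set" where
  "graph_of f = {(x, f x) | x. True}"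

(* The library predicate real_polynomial_function is defined inductively (linear functionals,
   constants, sums, products).  The lemma real_polynomial_function_iff_monomials below confirms
   that on R^n it means exactly: a finite real linear combination of monomials in the coordinates. *)

definition monomial_sum :: "(real ^ 'n \<Rightarrow> real) \<Rightarrow> bool" where
  "monomial_sum f \<longleftrightarrow> (\<exists>(A :: ('n \<Rightarrow> nat) set) c. finite A \<and>
     f = (\<lambda>x. \<Sum>a\<in>A. c a * (\<Prod>i\<in>UNIV. (x $ i) ^ a i)))"

lemma monomial_sum_add:
  fixes f g :: "real ^ 'n \<Rightarrow> real"
  assumes "monomial_sum f" "monomial_sum g"
  shows "monomial_sum (\<lambda>x. f x + g x)"
proof -
  obtain A c where A: "finite A" "f = (\<lambda>x. \<Sum>a\<in>A. c a * (\<Prod>i\<in>UNIV. (x $ i) ^ a i))"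
    using assms(1) unfolding monomial_sum_def by blast
  obtain B d where B: "finite B" "g = (\<lambda>x. \<Sum>a\<in>B. d a * (\<Prod>i\<in>UNIV. (x $ i) ^ a i))"
    using assms(2) unfolding monomial_sum_def by blast
  let ?c = "\<lambda>a. (if a \<in> A then c a else 0) + (if a \<in> B then d a else 0)"
  have 1: "f x = (\<Sum>a\<in>A\<union>B. (if a \<in> A then c a else 0) * (\<Prod>i\<in>UNIV. (x $ i) ^ a i))" for x
    unfolding A(2) by (rule sum.mono_neutral_cong_left) (use A B in auto)
  have 2: "g x = (\<Sum>a\<in>A\<union>B. (if a \<in> B then d a else 0) * (\<Prod>i\<in>UNIV. (x $ i) ^ a i))" for x
    unfolding B(2) by (rule sum.mono_neutral_cong_left) (use A B in auto)
  have "(\<lambda>x. f x + g x) = (\<lambda>x. \<Sum>a\<in>A\<union>B. ?c a * (\<Prod>i\<in>UNIV. (x $ i) ^ a i))"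
    unfolding 1 2 by (simp add: sum.distrib[symmetric] distrib_right)
  moreover have "finite (A \<union> B)" using A B by simp
  ultimately show ?thesis unfolding monomial_sum_def
    by (intro exI[of _ "A \<union> B"] exI[of _ ?c] conjI)
qed

lemma monomial_sum_monomial:
  fixes a :: "'n::finite \<Rightarrow> nat"
  shows "monomial_sum (\<lambda>x. c * (\<Prod>i\<in>UNIV. (x $ i) ^ a i))"
  unfolding monomial_sum_def by (rule exI[of _ "{a}"], rule exI[of _ "\<lambda>_. c"]) simp

lemma monomial_sum_const: "monomial_sum (\<lambda>x. c)"
  using monomial_sum_monomial[of c "\<lambda>_. 0"] by simp

lemma monomial_sum_sum:
  assumes "finite I" "\<And>i. i \<in> I \<Longrightarrow> monomial_sum (f i)"
  shows "monomial_sum (\<lambda>x. \<Sum>i\<in>I. f i x)"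
  using assms by (induction I) (auto intro: monomial_sum_add monomial_sum_const)

lemma monomial_sum_mult:
  fixes f g :: "real ^ 'n \<Rightarrow> real"
  assumes "monomial_sum f" "monomial_sum g"
  shows "monomial_sum (\<lambda>x. f x * g x)"
proof -
  obtain A c where A: "finite A" "f = (\<lambda>x. \<Sum>a\<in>A. c a * (\<Prod>i\<in>UNIV. (x $ i) ^ a i))"
    using assms(1) unfolding monomial_sum_def by blast
  obtain B d where B: "finite B" "g = (\<lambda>x. \<Sum>a\<in>B. d a * (\<Prod>i\<in>UNIV. (x $ i) ^ a i))"
    using assms(2) unfolding monomial_sum_def by blast
  have "(\<lambda>x. f x * g x) =
      (\<lambda>x. \<Sum>a\<in>A. \<Sum>b\<in>B. (c a * d b) * (\<Prod>i\<in>UNIV. (x $ i) ^ (a i + b i)))"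
    unfolding A(2) B(2) sum_product
    by (intro ext sum.cong refl) (simp add: power_add prod.distrib mult_ac)
  moreover have "monomial_sum \<dots>"
    using A B by (intro monomial_sum_sum monomial_sum_monomial)
  ultimately show ?thesis by simp
qed

lemma monomial_sum_coord: "monomial_sum (\<lambda>x :: real ^ 'n. c * x $ j)"
proof -
  have "(\<Prod>i\<in>UNIV. (x $ i) ^ (if i = j then 1 else 0 :: nat)) = x $ j" for x :: "real ^ 'n"
    by (simp add: if_distrib[of "\<lambda>k. _ ^ k"] cong: if_cong)
  then show ?thesis
    using monomial_sum_monomial[of c "\<lambda>i. if i = j then 1 else 0"] by simp
qed

lemma real_polynomial_function_iff_monomials:
  fixes f :: "real ^ 'n \<Rightarrow> real"
  shows "real_polynomial_function f \<longleftrightarrow>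
    (\<exists>(A :: ('n \<Rightarrow> nat) set) c. finite A \<and>
       f = (\<lambda>x. \<Sum>a\<in>A. c a * (\<Prod>i\<in>UNIV. (x $ i) ^ a i)))"
proof
  assume "real_polynomial_function f"
  then have "monomial_sum f"
  proof induction
    case (linear f)
    then have "linear f" by (rule bounded_linear.linear)
    define c where "c j = f (axis j 1)" for j
    have "f = (\<lambda>x. \<Sum>j\<in>UNIV. c j * x $ j)"
    proof
      fix x
      have "f x = f (\<Sum>j\<in>UNIV. x $ j *\<^sub>R axis j 1)"
        using basis_expansion[of x] by (simp add: scalar_mult_eq_scaleR)
      then show "f x = (\<Sum>j\<in>UNIV. c j * x $ j)"
        by (simp add: c_def linear_sum[OF \<open>linear f\<close>] linear_cmul[OF \<open>linear f\<close>] mult.commute)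
    qed
    moreover have "monomial_sum (\<lambda>x. \<Sum>j\<in>UNIV. c j * x $ j)"
      by (intro monomial_sum_sum monomial_sum_coord) simp
    ultimately show ?case by simp
  qed (auto intro: monomial_sum_const monomial_sum_add monomial_sum_mult)
  then show "\<exists>(A :: ('n \<Rightarrow> nat) set) c. finite A \<and>
      f = (\<lambda>x. \<Sum>a\<in>A. c a * (\<Prod>i\<in>UNIV. (x $ i) ^ a i))"
    unfolding monomial_sum_def .
next
  assume "\<exists>(A :: ('n \<Rightarrow> nat) set) c. finite A \<and>
      f = (\<lambda>x. \<Sum>a\<in>A. c a * (\<Prod>i\<in>UNIV. (x $ i) ^ a i))"
  then obtain A :: "('n \<Rightarrow> nat) set" and c where
    A: "finite A" and f: "f = (\<lambda>x. \<Sum>a\<in>A. c a * (\<Prod>i\<in>UNIV. (x $ i) ^ a i))" by blast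
  have coord: "real_polynomial_function (\<lambda>x :: real ^ 'n. x $ i)" for i
    by (rule real_polynomial_function.intros(1)) (rule bounded_linear_vec_nth)
  show "real_polynomial_function f"
    unfolding f using A coord
    by (intro real_polynomial_function_sum real_polynomial_function.intros(2,4)
        real_polynomial_function_prod
        real_polynomial_function_power) auto
qed

end

theory Submission
  imports Defs
begin

text \<open>
  Newton's forward difference formula shows that a solution of Frechet's equation agrees with an
  ordinary polynomial on the points with rational coordinates. Let \<open>p\<close> be this polynomial for
  \<open>f\<close>, choose \<open>z\<close> with \<open>f z \<noteq> p z\<close>, and let \<open>P\<close> be the polynomial that agrees with
  \<open>(s, r) \<mapsto> f (s + r z)\<close> at rational points. By density, all points \<open>(u, P (u - r z, r))\<close> lie in
  the closure of the graph, and the polynomial \<open>r \<mapsto> P (u - r z, r)\<close> is not constant for generic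
  \<open>u\<close>: at \<open>u = z\<close> it takes the values \<open>p z\<close> and \<open>f z\<close>. Over a small open set of \<open>u\<close> on which its
  degree is maximal, its values fill a half-line, so the closure of the graph contains an open
  half-cylinder over some part of every non-empty open set.
\<close>

section \<open>Newton's formula for solutions of Frechet's equation\<close>

lemma fwd_diff_Suc_shift:
  "fwd_diff (Suc k) h f = fwd_diff k h (\<lambda>x. f (x + h) - f x)"
  by (induction k) auto

lemma fwd_diff_diff:
  "fwd_diff k h (\<lambda>x. f x - g x) x = fwd_diff k h f x - fwd_diff k h g x"
  by (induction k arbitrary: x) auto

lemma fwd_diff_translate:
  "fwd_diff k h (\<lambda>x. f (x + a)) x = fwd_diff k h f (x + a)"
  by (induction k arbitrary: x) (auto simp: algebra_simps)

lemma fwd_diff_compose_additive: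
  assumes "\<And>x y. L (x + y) = L x + L y"
  shows "fwd_diff k h (\<lambda>x. f (L x)) x = fwd_diff k (L h) f (L x)"
  by (induction k arbitrary: x) (auto simp: assms)

text \<open>Difference operators commute: \<open>fwd_diff m h\<close> is linear and commutes with
  translations. Hence the coefficients \<open>fwd_diff k a f\<close> in Newton's formula inherit
  Frechet's equation, which the induction over the coordinates needs.\<close>

lemma fwd_diff_fwd_diff_eq_0:
  assumes "\<And>x. fwd_diff m h f x = 0"
  shows "fwd_diff m h (fwd_diff k a f) x = 0"
proof (induction k arbitrary: x)
  case (Suc k)
  then show ?case
    by (simp add: fwd_diff_diff fwd_diff_translate)
qed (simp add: assms)

lemma int_function_eq_0:
  fixes d :: "int \<Rightarrow> real"
  assumes "d 0 = 0" and step: "\<And>n. d (n + 1) = d n"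
  shows "d n = 0"
proof (induction n rule: int_induct[where k = 0])
  case (step2 i)
  then show ?case using step[of "i - 1"] by simp
qed (use assms in auto)

text \<open>As functions of \<open>n\<close>, both sides agree at 0 and have the same first
  difference, by Pascal's rule and the induction hypothesis for \<open>g (x + h) - g x\<close>. With
  \<open>gchoose\<close> the formula covers negative \<open>n\<close>, and its right side is a
  polynomial that can be evaluated at rational arguments.\<close>

lemma newton_forward_int:
  fixes g :: "'a::real_vector \<Rightarrow> real"
  assumes "\<And>x. fwd_diff (Suc m) h g x = 0"
  shows "g (x + of_int n *\<^sub>R h) = (\<Sum>k\<le>m. fwd_diff k h g x * (of_int n gchoose k))"
  using assms
proof (induction m arbitrary: g x n)
  case 0
  have "g (x + of_int n *\<^sub>R h) - g x = 0"
  proof (rule int_function_eq_0[where d = "\<lambda>n. g (x + of_int n *\<^sub>R h) - g x"])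
    fix n :: int
    show "g (x + of_int (n + 1) *\<^sub>R h) - g x = g (x + of_int n *\<^sub>R h) - g x"
      using 0[of "x + of_int n *\<^sub>R h"] by (simp add: algebra_simps)
  qed simp
  then show ?case by simp
next
  case (Suc m)
  define e where "e = (\<lambda>x. g (x + h) - g x)"
  have fe: "fwd_diff k h e = fwd_diff (Suc k) h g" for k
    unfolding e_def by (rule fwd_diff_Suc_shift[symmetric])
  have IH: "e (x + of_int n *\<^sub>R h) = (\<Sum>k\<le>m. fwd_diff (Suc k) h g x * (of_int n gchoose k))" for n
    using Suc.IH[of e] Suc.prems by (simp only: fe)
  define S where
    "S n = g x + (\<Sum>k\<le>m. fwd_diff (Suc k) h g x * (of_int n gchoose Suc k))" for n :: int
  have S: "(\<Sum>k\<le>Suc m. fwd_diff k h g x * (of_int n gchoose k)) = S n" for n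
    unfolding S_def by (subst sum.atMost_Suc_shift) simp
  have "g (x + of_int n *\<^sub>R h) - S n = 0"
  proof (rule int_function_eq_0[where d = "\<lambda>n. g (x + of_int n *\<^sub>R h) - S n"])
    fix n :: int
    have "S (n + 1) - S n = (\<Sum>k\<le>m. fwd_diff (Suc k) h g x *
        ((of_int n + 1 gchoose Suc k) - (of_int n gchoose Suc k)))"
      by (simp add: S_def sum_subtractf right_diff_distrib del: fwd_diff.simps)
    also have "\<dots> = e (x + of_int n *\<^sub>R h)"
      by (simp add: IH gbinomial_Suc_Suc del: fwd_diff.simps)
    finally have "S (n + 1) - S n = e (x + of_int n *\<^sub>R h)" .
    moreover have "e (x + of_int n *\<^sub>R h) = g (x + of_int (n + 1) *\<^sub>R h) - g (x + of_int n *\<^sub>R h)"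
      by (simp add: e_def algebra_simps)
    ultimately show "g (x + of_int (n + 1) *\<^sub>R h) - S (n + 1) = g (x + of_int n *\<^sub>R h) - S n"
      by simp
  qed (simp add: S_def)
  then show ?case unfolding S by simp
qed

lemma real_polynomial_function_compose':
  assumes "real_polynomial_function g" "polynomial_function f"
  shows "real_polynomial_function (\<lambda>x. g (f x))"
  using real_polynomial_function_compose[OF assms(2,1)] by (simp add: o_def)

lemma real_polynomial_function_gbinomial:
  fixes q :: "'a::real_normed_vector \<Rightarrow> real"
  assumes "real_polynomial_function q"
  shows "real_polynomial_function (\<lambda>x. q x gchoose k)"
proof -
  obtain p where p: "real_polynomial_function p" "\<And>x. x gchoose k = p x"
    using real_polynomial_function_gchoose by blast
  show ?thesis
    unfolding p(2)
    by (rule real_polynomial_function_compose'[OF p(1)])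
      (use assms in \<open>simp add: real_polynomial_function_eq\<close>)
qed

lemma real_polynomial_function_eq_0:
  fixes q :: "real \<Rightarrow> real"
  assumes q: "real_polynomial_function q" and inf: "infinite {t. q t = 0}"
  shows "q t = 0"
proof -
  obtain a n where a: "q = (\<lambda>x. \<Sum>i\<le>n. a i * x ^ i)"
    using real_polynomial_function_imp_sum[OF q] by blast
  then have "\<forall>i\<le>n. a i = 0"
    using inf polyfun_finite_roots[of a n] by auto
  then show ?thesis by (simp add: a)
qed

text \<open>With \<open>q = a / d\<close>, the Newton polynomials for the steps \<open>h\<close> and
  \<open>h / d\<close> describe the same values of \<open>g\<close> at integer multiples of
  \<open>h\<close>, so they are equal as polynomials after rescaling the argument by
  \<open>d\<close>. At \<open>q\<close> the second one has the integer argument \<open>a\<close>,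
  where the integer formula applies.\<close>

lemma newton_forward_rat:
  fixes g :: "'a::real_vector \<Rightarrow> real"
  assumes F: "\<And>h x. fwd_diff (Suc m) h g x = 0" and "q \<in> \<rat>"
  shows "g (x + q *\<^sub>R h) = (\<Sum>k\<le>m. fwd_diff k h g x * (q gchoose k))"
proof -
  obtain a d :: int where d: "d > 0" and q: "q = of_int a / of_int d"
    using \<open>q \<in> \<rat>\<close> by (auto elim: Rats_cases')
  define N where "N h t = (\<Sum>k\<le>m. fwd_diff k h g x * (t gchoose k))" for h t
  have N_int: "N h (of_int n) = g (x + of_int n *\<^sub>R h)" for h n
    unfolding N_def by (rule newton_forward_int[symmetric]) (rule F)
  have N_poly: "real_polynomial_function (\<lambda>t. N h (r t))" if "real_polynomial_function r" for h r
    unfolding N_def using that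
    by (intro real_polynomial_function_sum real_polynomial_function.intros(2,4)
        real_polynomial_function_gbinomial) auto
  define h' where "h' = (1 / of_int d) *\<^sub>R h"
  have "N h q - N h' (of_int d * q) = 0"
  \<comment> \<open>A polynomial in \<open>t\<close> that vanishes at all integers is zero.\<close>
  proof (rule real_polynomial_function_eq_0[where q = "\<lambda>t. N h t - N h' (of_int d * t)"])
    show "real_polynomial_function (\<lambda>t. N h t - N h' (of_int d * t))"
      by (intro real_polynomial_function_diff N_poly real_polynomial_function.intros(1)
          bounded_linear_ident bounded_linear_mult_right)
    have "N h (of_int n) - N h' (of_int d * of_int n) = 0" for n
    proof -
      have "of_int (d * n) *\<^sub>R h' = of_int n *\<^sub>R h" using d by (simp add: h'_def)
      then have "N h' (of_int (d * n)) = N h (of_int n)" by (simp only: N_int)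
      then show ?thesis by simp
    qed
    then have "range of_int \<subseteq> {t. N h t - N h' (of_int d * t) = 0}" by blast
    moreover have "infinite (range of_int :: real set)"
      by (metis finite_imageD infinite_UNIV_int inj_onI of_int_eq_iff)
    ultimately show "infinite {t. N h t - N h' (of_int d * t) = 0}"
      using finite_subset by blast
  qed
  moreover have "of_int d * q = of_int a" using d q by simp
  ultimately have "N h q = g (x + of_int a *\<^sub>R h')" using N_int[of h' a] by simp
  moreover have "of_int a *\<^sub>R h' = q *\<^sub>R h" by (simp add: h'_def q)
  ultimately show ?thesis by (simp only: N_def)
qed

section \<open>Agreement with a polynomial at rational points\<close>

text \<open>Coordinates are added one at a time. In a new direction \<open>b\<close>, Newton's
  formula is polynomial in the coordinate along \<open>b\<close>, and its coefficients
  \<open>fwd_diff k b g\<close> again solve Frechet's equation, so they are polynomial on the span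
  of \<open>B\<close> by induction. This is why \<open>g\<close> is generalized.\<close>

lemma frechet_polynomial_on_rational_span:
  fixes g :: "'a::euclidean_space \<Rightarrow> real"
  assumes "B \<subseteq> Basis" and "\<And>h x. fwd_diff (Suc m) h g x = 0"
  shows "\<exists>p. real_polynomial_function p \<and>
    (\<forall>c \<in> B \<rightarrow> \<rat>. g (\<Sum>b\<in>B. c b *\<^sub>R b) = p (\<Sum>b\<in>B. c b *\<^sub>R b))"
  using finite_subset[OF assms(1) finite_Basis] assms
proof (induction B arbitrary: g rule: finite_induct)
  case empty
  show ?case by (rule exI[of _ "\<lambda>_. g 0"]) (auto intro: real_polynomial_function.intros)
next
  case (insert b B)
  have b: "b \<in> Basis" and B: "B \<subseteq> Basis" using insert.prems by auto
  have "\<exists>p. real_polynomial_function p \<and>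
      (\<forall>c \<in> B \<rightarrow> \<rat>. fwd_diff k b g (\<Sum>b\<in>B. c b *\<^sub>R b) = p (\<Sum>b\<in>B. c b *\<^sub>R b))" for k
    by (rule insert.IH[OF B]) (rule fwd_diff_fwd_diff_eq_0, rule insert.prems(2))
  then obtain p where p: "\<And>k. real_polynomial_function (p k)"
    "\<And>k c. c \<in> B \<rightarrow> \<rat> \<Longrightarrow> fwd_diff k b g (\<Sum>b\<in>B. c b *\<^sub>R b) = p k (\<Sum>b\<in>B. c b *\<^sub>R b)"
    by metis
  \<comment> \<open>The argument \<open>y - (y \<bullet> b) *\<^sub>R b\<close> is \<open>y\<close>
    with its \<open>b\<close>-coordinate removed, the base point at which the coefficients are
    taken.\<close>
  define P where "P y = (\<Sum>k\<le>m. p k (y - (y \<bullet> b) *\<^sub>R b) * ((y \<bullet> b) gchoose k))" for y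
  have inner: "real_polynomial_function (\<lambda>y. y \<bullet> b)"
    by (intro real_polynomial_function.intros bounded_linear_inner_left)
  then have "polynomial_function (\<lambda>y. y - (y \<bullet> b) *\<^sub>R b)"
    by (intro polynomial_function_diff polynomial_function_mult polynomial_function_id
        polynomial_function_const) (auto simp: real_polynomial_function_eq)
  then have "real_polynomial_function (\<lambda>y. p k (y - (y \<bullet> b) *\<^sub>R b))" for k
    by (rule real_polynomial_function_compose'[OF p(1)])
  then have "real_polynomial_function P"
    unfolding P_def using inner
    by (intro real_polynomial_function_sum real_polynomial_function.intros(4)
        real_polynomial_function_gbinomial) auto
  moreover have "g (\<Sum>b\<in>insert b B. c b *\<^sub>R b) = P (\<Sum>b\<in>insert b B. c b *\<^sub>R b)"
    if c: "c \<in> insert b B \<rightarrow> \<rat>" for c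
  proof -
    define x where "x = (\<Sum>b\<in>B. c b *\<^sub>R b)"
    have y: "(\<Sum>b\<in>insert b B. c b *\<^sub>R b) = x + c b *\<^sub>R b"
      using insert.hyps by (simp add: x_def add.commute)
    have "x \<bullet> b = 0"
      unfolding x_def inner_sum_left
    proof (intro sum.neutral ballI)
      fix i assume "i \<in> B"
      then have "i \<bullet> b = 0" using insert.hyps B b by (intro inner_not_same_Basis) auto
      then show "(c i *\<^sub>R i) \<bullet> b = 0" by simp
    qed
    then have yb: "(x + c b *\<^sub>R b) \<bullet> b = c b"
      using b by (simp add: inner_add_left)
    have "g (x + c b *\<^sub>R b) = (\<Sum>k\<le>m. fwd_diff k b g x * (c b gchoose k))"
      by (rule newton_forward_rat[OF insert.prems(2)]) (use c in auto)
    also have "\<dots> = P (x + c b *\<^sub>R b)"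
      unfolding P_def yb using p(2)[of c] c by (simp add: x_def)
    finally show ?thesis by (simp only: y)
  qed
  ultimately show ?case by (intro exI[of _ P] conjI ballI)
qed

definition rational_points :: "'a::euclidean_space set" where
  "rational_points = {x. \<forall>b\<in>Basis. x \<bullet> b \<in> \<rat>}"

lemma closure_rational_points: "closure rational_points = UNIV"
proof -
  have "(\<Union>f \<in> Basis \<rightarrow> \<rat>. {\<Sum>i::'a\<in>Basis. f i *\<^sub>R i}) \<subseteq> rational_points"
    by (auto simp: rational_points_def)
  from closure_mono[OF this] show ?thesis
    unfolding closure_rational_coordinates by blast
qed

lemma frechet_polynomial_on_rational_points:
  fixes g :: "'a::euclidean_space \<Rightarrow> real"
  assumes "\<And>h x. fwd_diff (Suc m) h g x = 0"
  obtains p where "real_polynomial_function p" "\<And>x. x \<in> rational_points \<Longrightarrow> g x = p x"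
proof -
  obtain p where p: "real_polynomial_function p"
    "\<And>c. c \<in> Basis \<rightarrow> \<rat> \<Longrightarrow> g (\<Sum>b\<in>Basis. c b *\<^sub>R b) = p (\<Sum>b\<in>Basis. c b *\<^sub>R b)"
    using frechet_polynomial_on_rational_span[OF order_refl assms] by metis
  have "g x = p x" if "x \<in> rational_points" for x
    using p(2)[of "\<lambda>b. x \<bullet> b"] that by (simp add: rational_points_def euclidean_representation)
  with p(1) show ?thesis by (rule that)
qed

text \<open>The polynomial \<open>P\<close> for \<open>f\<close> composed with \<open>L\<close>
  yields limit points of the graph by density, while the real direction \<open>z\<close> is where
  \<open>f\<close> departs from its polynomial \<open>p\<close>. The two values of \<open>Q\<close>
  at \<open>z\<close> are \<open>p z\<close> and \<open>f z\<close>.\<close>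

lemma polynomial_in_closure_graph:
  fixes f :: "'a::euclidean_space \<Rightarrow> real"
  assumes F: "\<And>h x. fwd_diff (Suc m) h f x = 0" and np: "\<not> real_polynomial_function f"
  obtains Q :: "'a \<times> real \<Rightarrow> real" and z
  where "real_polynomial_function Q" "\<And>u r. (u, Q (u, r)) \<in> closure (graph_of f)"
    "Q (z, 0) \<noteq> Q (z, 1)"
proof -
  obtain p where p: "real_polynomial_function p" "\<And>x. x \<in> rational_points \<Longrightarrow> f x = p x"
    using frechet_polynomial_on_rational_points[OF F] by blast
  have "f \<noteq> p" using p(1) np by auto
  then obtain z where z: "f z \<noteq> p z" by (auto simp: fun_eq_iff)
  define L where "L = (\<lambda>v :: 'a \<times> real. fst v + snd v *\<^sub>R z)"
  have "L (v + w) = L v + L w" for v w by (simp add: L_def algebra_simps)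
  then have "fwd_diff (Suc m) h (\<lambda>v. f (L v)) v = fwd_diff (Suc m) (L h) f (L v)" for h v
    by (rule fwd_diff_compose_additive)
  then have FL: "fwd_diff (Suc m) h (\<lambda>v. f (L v)) v = 0" for h v
    by (simp only: F)
  obtain P where P: "real_polynomial_function P"
    "\<And>v. v \<in> rational_points \<Longrightarrow> f (L v) = P v"
    using frechet_polynomial_on_rational_points[OF FL] by blast
  have contP: "continuous_on S P" for S
    by (rule continuous_on_polymonial_function) (use P(1) in \<open>simp add: real_polynomial_function_eq\<close>)
  have contp: "continuous_on S p" for S
    by (rule continuous_on_polymonial_function) (use p(1) in \<open>simp add: real_polynomial_function_eq\<close>)
  have "(\<lambda>v. (L v, P v)) ` closure rational_points \<subseteq> closure (graph_of f)"
  proof (rule image_closure_subset)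
    show "continuous_on (closure rational_points) (\<lambda>v. (L v, P v))"
      unfolding L_def by (intro continuous_intros contP)
    have "(\<lambda>v. (L v, P v)) ` rational_points \<subseteq> graph_of f"
      using P(2) by (auto simp: graph_of_def)
    then show "(\<lambda>v. (L v, P v)) ` rational_points \<subseteq> closure (graph_of f)"
      using closure_subset by blast
  qed simp
  then have cl: "(L v, P v) \<in> closure (graph_of f)" for v
    by (auto simp: closure_rational_points)
  \<comment> \<open>Both sides are continuous in \<open>s\<close> and equal \<open>f s\<close> at
    rational \<open>s\<close>.\<close>
  have P0: "P (s, 0) = p s" for s
  proof -
    have "(\<lambda>s. P (s, 0) - p s) ` closure rational_points \<subseteq> {0}"
    proof (rule image_closure_subset)
      show "continuous_on (closure rational_points) (\<lambda>s. P (s, 0) - p s)"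
        by (intro continuous_intros contp continuous_on_compose2[OF contP[of UNIV]]) auto
      show "(\<lambda>s. P (s, 0) - p s) ` rational_points \<subseteq> {0}"
      proof clarsimp
        fix s :: 'a assume s: "s \<in> rational_points"
        then have "(s, 0::real) \<in> rational_points"
          by (auto simp: rational_points_def Basis_prod_def)
        then show "P (s, 0) = p s" using P(2)[of "(s, 0)"] p(2)[OF s] by (simp add: L_def)
      qed
    qed simp
    then show ?thesis by (auto simp: closure_rational_points image_subset_iff)
  qed
  \<comment> \<open>This rational point is sent by \<open>L\<close> to \<open>z\<close>, which
    itself need not be rational.\<close>
  have "(0::'a, 1::real) \<in> rational_points"
    by (auto simp: rational_points_def Basis_prod_def)
  then have P1: "P (0, 1) = f z" using P(2)[of "(0, 1)"] by (simp add: L_def)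
  \<comment> \<open>The shear undoes \<open>L\<close>: the point obtained from
    \<open>(u - r *\<^sub>R z, r)\<close> lies over \<open>u\<close> for every
    \<open>r\<close>.\<close>
  define Q where "Q = (\<lambda>v. P (fst v - snd v *\<^sub>R z, snd v))"
  have "bounded_linear (\<lambda>v :: 'a \<times> real. (fst v - snd v *\<^sub>R z, snd v))"
    by (intro bounded_linear_Pair bounded_linear_sub bounded_linear_fst bounded_linear_snd
        bounded_linear_compose[OF bounded_linear_scaleR_left])
  then have "real_polynomial_function Q"
    unfolding Q_def
    by (rule real_polynomial_function_compose'[OF P(1) polynomial_function_bounded_linear])
  moreover have "(u, Q (u, r)) \<in> closure (graph_of f)" for u r
    using cl[of "(u - r *\<^sub>R z, r)"] by (simp add: L_def Q_def)
  moreover have "Q (z, 0) \<noteq> Q (z, 1)"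
    using z by (simp add: Q_def P0 P1)
  ultimately show ?thesis by (rule that)
qed

section \<open>Half-lines filled by a polynomial with parameters\<close>

text \<open>On the line from \<open>u\<close> to \<open>z\<close>, \<open>w\<close> becomes a
  polynomial in one variable with infinitely many zeros near the parameter 0, so it also vanishes at
  the parameter 1.\<close>

lemma real_polynomial_function_eq_0_open:
  fixes w :: "'a::real_normed_vector \<Rightarrow> real"
  assumes w: "real_polynomial_function w" and U: "open U" "u \<in> U" and 0: "\<And>x. x \<in> U \<Longrightarrow> w x = 0"
  shows "w z = 0"
proof -
  define l where "l = (\<lambda>t::real. u + t *\<^sub>R (z - u))"
  have "polynomial_function l"
    unfolding l_def
    by (intro polynomial_function_add polynomial_function_const polynomial_function_mult
        polynomial_function_id)
  then have "real_polynomial_function (\<lambda>t. w (l t))"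
    by (rule real_polynomial_function_compose'[OF w])
  moreover have "infinite {t. w (l t) = 0}"
  proof -
    have "open (l -` U)"
      using U(1) by (intro open_vimage) (auto simp: l_def intro!: continuous_intros)
    moreover have "0 \<in> l -` U" using U(2) by (simp add: l_def)
    ultimately have "infinite (l -` U)"
      using infinite_openin[of UNIV "l -` U" 0] not_open_singleton finite_imp_not_open by blast
    moreover have "l -` U \<subseteq> {t. w (l t) = 0}" using 0 by auto
    ultimately show ?thesis using finite_subset by blast
  qed
  ultimately have "w (l 1) = 0"
    by (rule real_polynomial_function_eq_0)
  then show ?thesis by (simp add: l_def)
qed

text \<open>\<open>Q\<close> is viewed as a polynomial in \<open>r\<close> whose coefficients are
  polynomials in \<open>u\<close>. The uniform bound \<open>N\<close> later guarantees that a
  maximal degree exists.\<close>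

lemma real_polynomial_function_as_poly:
  fixes Q :: "'a::real_normed_vector \<times> real \<Rightarrow> real"
  assumes "real_polynomial_function Q"
  shows "\<exists>(p :: 'a \<Rightarrow> real poly) N. (\<forall>u r. Q (u, r) = poly (p u) r) \<and> (\<forall>u. degree (p u) \<le> N) \<and>
    (\<forall>j. real_polynomial_function (\<lambda>u. coeff (p u) j))"
  using assms
proof induction
  case (linear Q)
  then have affine: "Q (u, r) = Q (u, 0) + r * Q (0, 1)" for u r
    using linear_add[of Q "(u, 0)" "(0, r)"] linear_cmul[of Q r "(0, 1)"]
    by (simp add: bounded_linear.linear)
  have "Q (u, r) = poly [:Q (u, 0), Q (0, 1):] r" for u r
    unfolding poly_pCons poly_0 mult_zero_right add_0_right by (rule affine)
  moreover have "bounded_linear (\<lambda>u. Q (u, 0))"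
    by (intro bounded_linear_compose[OF linear] bounded_linear_Pair bounded_linear_ident
        bounded_linear_zero)
  then have "real_polynomial_function (\<lambda>u. coeff [:Q (u, 0), Q (0, 1):] j)" for j
    by (cases j) (simp_all add: real_polynomial_function.intros(1,2))
  moreover have "degree [:Q (u, 0), Q (0, 1):] \<le> 1" for u by simp
  ultimately show ?case
    by (intro exI[of _ "\<lambda>u. [:Q (u, 0), Q (0, 1):]"] exI[of _ 1] conjI allI)
next
  case (const c)
  have "real_polynomial_function (\<lambda>u::'a. coeff [:c:] j)" for j
    by (rule real_polynomial_function.intros)
  then show ?case by (intro exI[of _ "\<lambda>u. [:c:]"] exI[of _ 0]) auto
next
  case (add Q1 Q2)
  then obtain p1 N1 p2 N2 where *:
    "\<forall>u r. Q1 (u, r) = poly (p1 u) r" "\<forall>u. degree (p1 u) \<le> N1"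
    "\<forall>j. real_polynomial_function (\<lambda>u. coeff (p1 u) j)"
    "\<forall>u r. Q2 (u, r) = poly (p2 u) r" "\<forall>u. degree (p2 u) \<le> N2"
    "\<forall>j. real_polynomial_function (\<lambda>u. coeff (p2 u) j)"
    by blast
  have "degree (p1 u + p2 u) \<le> max N1 N2" for u
    using *(2,5) by (intro degree_add_le) (auto simp: le_max_iff_disj)
  moreover have "real_polynomial_function (\<lambda>u. coeff (p1 u + p2 u) j)" for j
    unfolding coeff_add using *(3,6) by (intro real_polynomial_function.intros(3)) auto
  ultimately show ?case
    using *(1,4) by (intro exI[of _ "\<lambda>u. p1 u + p2 u"] exI[of _ "max N1 N2"]) auto
next
  case (mult Q1 Q2)
  then obtain p1 N1 p2 N2 where *:
    "\<forall>u r. Q1 (u, r) = poly (p1 u) r" "\<forall>u. degree (p1 u) \<le> N1"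
    "\<forall>j. real_polynomial_function (\<lambda>u. coeff (p1 u) j)"
    "\<forall>u r. Q2 (u, r) = poly (p2 u) r" "\<forall>u. degree (p2 u) \<le> N2"
    "\<forall>j. real_polynomial_function (\<lambda>u. coeff (p2 u) j)"
    by blast
  have "degree (p1 u * p2 u) \<le> N1 + N2" for u
    using degree_mult_le[of "p1 u" "p2 u"] *(2,5) add_mono order_trans by blast
  moreover have "real_polynomial_function (\<lambda>u. coeff (p1 u * p2 u) j)" for j
    unfolding coeff_mult using *(3,6)
    by (intro real_polynomial_function_sum real_polynomial_function.intros(4)) auto
  ultimately show ?case
    using *(1,4) by (intro exI[of _ "\<lambda>u. p1 u * p2 u"] exI[of _ "N1 + N2"]) auto
qed

text \<open>Writing \<open>p\<close> as \<open>a + x * q\<close>, the factor \<open>q\<close>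
  eventually stays above its positive leading coefficient, so \<open>p\<close> grows at least
  linearly; the intermediate value theorem does the rest.\<close>

lemma poly_attains_above:
  fixes p :: "real poly"
  assumes "degree p > 0" "lead_coeff p > 0" "poly p 0 \<le> y"
  shows "\<exists>r. poly p r = y"
proof -
  obtain a q where p: "p = pCons a q" by (cases p)
  with assms have "q \<noteq> 0" by auto
  with assms(2) p have lc: "lead_coeff q > 0" by simp
  then obtain n where n: "\<And>x. x \<ge> n \<Longrightarrow> poly q x \<ge> lead_coeff q"
    using poly_pinfty_gt_lc by blast
  define x where "x = max n (max 0 ((y - a) / lead_coeff q))"
  have x: "x \<ge> n" "x \<ge> 0" "x \<ge> (y - a) / lead_coeff q" by (auto simp: x_def)
  from x(3) lc have "y - a \<le> x * lead_coeff q" by (simp add: divide_le_eq)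
  also have "\<dots> \<le> x * poly q x" using n x by (intro mult_left_mono) auto
  finally have "y \<le> poly p x" by (simp add: p)
  with assms(3) x(2) show ?thesis
    using IVT'[of "poly p" 0 y x] continuous_at_imp_continuous_on[of "{0..x}" "poly p"] by auto
qed

text \<open>Where the degree in \<open>r\<close> is locally constant and positive, the leading
  coefficient keeps its sign near a point, and this sign decides between an upper and a lower
  half-line. The bound \<open>M\<close> is uniform over \<open>V\<close>.\<close>

lemma polynomial_fills_half_lines:
  fixes Q :: "'a::real_normed_vector \<times> real \<Rightarrow> real"
  assumes Q: "real_polynomial_function Q" and z: "Q (z, 0) \<noteq> Q (z, 1)"
    and U: "open U" "U \<noteq> {}"
  obtains V M where "open V" "V \<noteq> {}" "V \<subseteq> U"
    "(\<forall>u\<in>V. \<forall>y>M. \<exists>r. Q (u, r) = y) \<or> (\<forall>u\<in>V. \<forall>y<M. \<exists>r. Q (u, r) = y)"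
proof -
  obtain p N where p: "\<And>u r. Q (u, r) = poly (p u) r" "\<And>u. degree (p u) \<le> N"
    "\<And>j. real_polynomial_function (\<lambda>u. coeff (p u) j)"
    using real_polynomial_function_as_poly[OF Q] by blast
  have cont_coeff: "continuous_on UNIV (\<lambda>u. coeff (p u) j)" for j
    by (rule continuous_on_polymonial_function) (use p(3) in \<open>simp add: real_polynomial_function_eq\<close>)
  have "polynomial_function (\<lambda>u::'a. (u, 0::real) + (0, r))" for r
    by (intro polynomial_function_add polynomial_function_const polynomial_function_bounded_linear
        bounded_linear_Pair bounded_linear_ident bounded_linear_zero)
  then have Qr: "real_polynomial_function (\<lambda>u. Q (u, r))" for r
    using real_polynomial_function_compose'[OF Q] by fastforce
  define w where "w u = Q (u, 0) - Q (u, 1)" for u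
  have w: "real_polynomial_function w"
    unfolding w_def by (intro real_polynomial_function_diff Qr)
  have contw: "continuous_on UNIV w"
    by (rule continuous_on_polymonial_function) (use w in \<open>simp add: real_polynomial_function_eq\<close>)
  \<comment> \<open>For \<open>u\<close> in \<open>S\<close> the values at 0 and 1 differ, so the
    polynomial in \<open>r\<close> is not constant.\<close>
  define S where "S = {u \<in> U. w u \<noteq> 0}"
  have "S \<noteq> {}"
  proof
    assume "S = {}"
    then have w0: "w x = 0" if "x \<in> U" for x using that by (auto simp: S_def)
    obtain u where u: "u \<in> U" using U(2) by blast
    have "w z = 0" by (rule real_polynomial_function_eq_0_open[OF w U(1) u w0])
    then show False using z by (simp add: w_def)
  qed
  have "open S"
  proof -
    have "open (w -` (- {0}))" by (intro open_vimage contw) auto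
    moreover have "S = U \<inter> w -` (- {0})" by (auto simp: S_def)
    ultimately show ?thesis using U(1) by auto
  qed
  \<comment> \<open>Near a point of maximal degree \<open>D\<close> the coefficient of index
    \<open>D\<close> stays nonzero, which forces degree exactly \<open>D\<close> there. The bound
    \<open>Suc N\<close> below serves as a strict bound on the degrees.\<close>
  define u0 where "u0 = (ARG_MAX (\<lambda>u. degree (p u)) u. u \<in> S)"
  have u0: "u0 \<in> S" "\<And>u. u \<in> S \<Longrightarrow> degree (p u) \<le> degree (p u0)"
    using \<open>S \<noteq> {}\<close> p(2) arg_max_nat_lemma[of "\<lambda>u. u \<in> S" _ "\<lambda>u. degree (p u)" "Suc N"]
    unfolding u0_def by (auto simp: less_Suc_eq_le)
  define D where "D = degree (p u0)"
  have "w u0 \<noteq> 0" using u0 by (simp add: S_def)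
  then have D: "D > 0"
    unfolding D_def w_def p(1) by (auto intro!: gr0I elim!: degree_eq_zeroE)
  have "coeff (p u0) D \<noteq> 0"
    using D by (auto simp: D_def)
  \<comment> \<open>The sign \<sigma>, used with the values 1 and -1, treats both signs of the
    leading coefficient at once.\<close>
  have half: "\<exists>V M. open V \<and> V \<noteq> {} \<and> V \<subseteq> U \<and>
      (\<forall>u\<in>V. \<forall>y>M. \<exists>r. \<sigma> * Q (u, r) = y)"
    if \<sigma>: "\<sigma> * coeff (p u0) D > 0" for \<sigma> :: real
  proof -
    \<comment> \<open>\<open>M\<close> exceeds the value of \<sigma> times the polynomial at
      \<open>r = 0\<close> throughout \<open>V\<close>, so every \<open>y > M\<close> lies above the
      starting value for the intermediate value theorem.\<close>
    define M where "M = \<sigma> * coeff (p u0) 0 + 1"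
    define V where "V = S \<inter> (\<lambda>u. \<sigma> * coeff (p u) D) -` {0<..} \<inter> (\<lambda>u. \<sigma> * coeff (p u) 0) -` {..<M}"
    have "open V"
      unfolding V_def
      by (intro open_Int open_vimage continuous_intros cont_coeff \<open>open S\<close>)
    moreover have "u0 \<in> V" using u0 \<sigma> by (simp add: V_def M_def)
    moreover have "V \<subseteq> U" by (auto simp: V_def S_def)
    moreover have "\<exists>r. \<sigma> * Q (u, r) = y" if u: "u \<in> V" and y: "y > M" for u y
    proof -
      have "\<sigma> * coeff (p u) D > 0" and u': "u \<in> S" "\<sigma> * coeff (p u) 0 < M"
        using u by (auto simp: V_def)
      moreover from this have "coeff (p u) D \<noteq> 0" by auto
      then have "degree (p u) = D"
        using u0(2)[OF u'(1)] le_degree[of "p u" D] by (simp add: D_def)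
      ultimately have "\<exists>r. poly (smult \<sigma> (p u)) r = y"
        using D y by (intro poly_attains_above) (auto simp: poly_0_coeff_0)
      then show ?thesis by (simp add: p(1))
    qed
    ultimately show ?thesis by blast
  qed
  show ?thesis
  proof (cases "coeff (p u0) D > 0")
    case True
    then have "1 * coeff (p u0) D > 0" by simp
    from half[OF this] obtain V M where V: "open V" "V \<noteq> {}" "V \<subseteq> U"
      and M: "\<forall>u\<in>V. \<forall>y>M. \<exists>r. 1 * Q (u, r) = y"
      by blast
    show ?thesis by (rule that[OF V disjI1[OF M[unfolded mult_1]]])
  next
    case False
    with \<open>coeff (p u0) D \<noteq> 0\<close> have "- 1 * coeff (p u0) D > 0" by simp
    from half[OF this] obtain V M where V: "open V" "V \<noteq> {}" "V \<subseteq> U"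
      and M: "\<forall>u\<in>V. \<forall>y>M. \<exists>r. - 1 * Q (u, r) = y"
      by blast
    have "\<forall>u\<in>V. \<forall>y<(- M). \<exists>r. Q (u, r) = y"
    proof (intro ballI allI impI)
      fix u y assume "u \<in> V" "y < - M"
      then obtain r where "- 1 * Q (u, r) = - y" using M[rule_format, of u "- y"] by auto
      then show "\<exists>r. Q (u, r) = y" by (intro exI[of _ r]) simp
    qed
    then show ?thesis by (rule that[OF V disjI2])
  qed
qed

section \<open>Unbounded cylinders in the closure of the graph\<close>

theorem theorem2p5:
  fixes f :: "real ^ 'n \<Rightarrow> real" and m :: nat
  assumes "\<forall>x h. fwd_diff (m + 1) h f x = 0"
    and "\<not> real_polynomial_function f"
  shows "locally_unbounded f \<and>
    (\<exists>W. open W \<and> \<not> bounded W \<and> W \<subseteq> closure (graph_of f))"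
proof -
  have F: "fwd_diff (Suc m) h f x = 0" for h x
    using assms(1) by (simp only: Suc_eq_plus1)
  obtain Q :: "(real ^ 'n) \<times> real \<Rightarrow> real" and z
    where Q: "real_polynomial_function Q" "Q (z, 0) \<noteq> Q (z, 1)"
    and cl: "\<And>u r. (u, Q (u, r)) \<in> closure (graph_of f)"
    using polynomial_in_closure_graph[OF F assms(2)] by metis
  \<comment> \<open>Such cylinders over every non-empty open \<open>U\<close> give both conclusions:
    arbitrary \<open>U\<close> for local unboundedness, and \<open>U = UNIV\<close> for the
    unbounded open set.\<close>
  have cyl: "\<exists>V Y. open V \<and> V \<noteq> {} \<and> V \<subseteq> U \<and> open Y \<and> \<not> bounded Y \<and> V \<times> Y \<subseteq> closure (graph_of f)"
    if U: "open U" "U \<noteq> {}" for U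
  proof -
    obtain V M where V: "open V" "V \<noteq> {}" "V \<subseteq> U"
      and "(\<forall>u\<in>V. \<forall>y>M. \<exists>r. Q (u, r) = y) \<or> (\<forall>u\<in>V. \<forall>y<M. \<exists>r. Q (u, r) = y)"
      using polynomial_fills_half_lines[OF Q U] by metis
    then have "V \<times> {M<..} \<subseteq> closure (graph_of f) \<or> V \<times> {..<M} \<subseteq> closure (graph_of f)"
      using cl by (fastforce simp: subset_iff)
    moreover have "\<not> bounded {M<..}" "\<not> bounded {..<M}"
    proof -
      have "max M B + 1 \<in> {M<..} \<and> max M B + 1 > B" "min M B - 1 \<in> {..<M} \<and> min M B - 1 < B" for B
        by auto
      then have "\<not> bdd_above {M<..}" "\<not> bdd_below {..<M}"
        unfolding bdd_above_def bdd_below_def by (meson not_le)+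
      then show "\<not> bounded {M<..}" "\<not> bounded {..<M}"
        by (auto dest: bounded_imp_bdd_above bounded_imp_bdd_below)
    qed
    ultimately show ?thesis using V open_greaterThan open_lessThan by metis
  qed
  have "locally_unbounded f"
    unfolding locally_unbounded_def
  proof (intro allI impI notI)
    fix U :: "(real ^ 'n) set" assume U: "open U \<and> U \<noteq> {}" and "bounded (f ` U)"
    then have *: "compact (closure (f ` U))" by (simp add: compact_closure)
    obtain V Y u where VY: "V \<subseteq> U" "u \<in> V" "\<not> bounded Y" "V \<times> Y \<subseteq> closure (graph_of f)"
      using cyl[of U] U by blast
    \<comment> \<open>As \<open>U\<close> is open, \<open>U \<times> T\<close> is a neighbourhood of
      \<open>(u, y)\<close> and meets the graph, so \<open>y\<close> is a limit of values of
      \<open>f\<close> on \<open>U\<close>. An unbounded \<open>Y\<close> then contradicts the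
      boundedness of these values.\<close>
    have "Y \<subseteq> closure (f ` U)"
    proof
      fix y assume "y \<in> Y"
      with VY have uy: "(u, y) \<in> closure (graph_of f)" "u \<in> U" by auto
      show "y \<in> closure (f ` U)"
        unfolding closure_iff_nhds_not_empty
      proof (intro allI impI notI)
        fix A T assume "T \<subseteq> A" "y \<in> T" "open T" "f ` U \<inter> A = {}"
        moreover have "graph_of f \<inter> U \<times> T \<noteq> {}"
          using uy U \<open>y \<in> T\<close> \<open>open T\<close> open_Times[of U T]
          unfolding closure_iff_nhds_not_empty by blast
        ultimately show False by (auto simp: graph_of_def)
      qed
    qed
    then show False using * VY(3) bounded_subset compact_imp_bounded by blast
  qed
  moreover have "\<exists>W. open W \<and> \<not> bounded W \<and> W \<subseteq> closure (graph_of f)"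
  proof -
    obtain V Y where VY: "open V" "V \<noteq> {}" "open Y" "\<not> bounded Y" "V \<times> Y \<subseteq> closure (graph_of f)"
      using cyl[of UNIV] by auto
    then have "snd ` (V \<times> Y) = Y" by auto
    then have "\<not> bounded (V \<times> Y)" using VY(4) bounded_snd by metis
    then show ?thesis using VY open_Times by blast
  qed
  ultimately show ?thesis by blast
qed

end
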